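(* Let $N \geq 14$ be an even integer and suppose $p_1, p_2$ are primes with $N = p_1 + p_2$. Then: (1) If $N$ has remainder $2$ when divided by $6$, then either one of $p_1, p_2$ is equal to $3$ and the other is in Column D, or both $p_1$ and $p_2$ are in Column F. (2) If $N$ has remainder $4$ when divided by $6$, then either one of $p_1, p_2$ is equal to $3$ and the other is in Column F, or both $p_1$ and $p_2$ are in Column D. (3) If $N$ has remainder $0$ when divided by $6$, then one of $p_1, p_2$ is in Column D and the other is in Column F.
   Context: The integers $\geq 2$ are arranged in a table with six columns A, B, C, D, E, F, whose row $x$ ($x = 1, 2, 3, \dots$) consists, with $y = x-1$, of the integers $2+6y,\ 3+6y,\ 4+6y,\ 5+6y,\ 6+6y,\ 7+6y$ in Columns A, B, C, D, E, F respectively. In particular, Column D is the set $\{5+6y : y \geq 0 \text{ an integer}\}$ and Column F is the set $\{7+6y : y \geq 0 \text{ an integer}\}$. *)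

theory Defs
  imports "HOL-Computational_Algebra.Primes"
begin

(* Row y + 1 of the table consists of 2 + 6y, ..., 7 + 6y in columns A, ..., F,
   so column F starts at 7 and does not contain 1. *)

definition column_D :: "nat set" where
  "column_D = {5 + 6 * y | y. True}"

definition column_F :: "nat set" where
  "column_F = {7 + 6 * y | y. True}"

end

theory Submission
  imports Defs
begin

text \<open>Columns D and F are the residue classes 5 and 1 mod 6, without 1 itself
  (\<open>column_D_iff\<close>, \<open>column_F_iff\<close>). A prime other than 2 and 3 is coprime
  to 6, so it lies in one of them (\<open>prime_mod_6\<close>). Since N is even and at least 14,
  neither summand is 2 and they are not both 3; adding the remaining residues mod 6 gives the three
  cases.\<close>

lemma column_D_iff: "n \<in> column_D \<longleftrightarrow> n mod 6 = 5"
proof -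
  have "n = 5 + 6 * (n div 6)" if "n mod 6 = 5"
    using that div_mult_mod_eq[of n 6] by linarith
  moreover have "(5 + 6 * y) mod 6 = 5" for y :: nat
    by presburger
  ultimately show ?thesis
    unfolding column_D_def by blast
qed

lemma column_F_iff: "n \<in> column_F \<longleftrightarrow> n mod 6 = 1 \<and> n \<noteq> 1"
proof -
  have "n = 7 + 6 * (n div 6 - 1)" if "n mod 6 = 1" "n \<noteq> 1"
    \<comment> \<open>Quotient 0 would force n = 1; otherwise the truncated
      \<open>n div 6 - 1\<close> is a true difference.\<close>
    using that div_mult_mod_eq[of n 6] by (cases "n div 6") auto
  moreover have "(7 + 6 * y) mod 6 = 1" for y :: nat
    by presburger
  ultimately show ?thesis
    unfolding column_F_def by fastforce
qed

text \<open>Residues 0, 2, 4 mod 6 force divisibility by 2, and residue 3 forces divisibility by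
  3.\<close>

lemma prime_mod_6:
  fixes p :: nat
  assumes "prime p"
  shows "p = 2 \<or> p = 3 \<or> p mod 6 = 1 \<or> p mod 6 = 5"
proof -
  have "2 dvd p \<Longrightarrow> p = 2" "3 dvd p \<Longrightarrow> p = 3"
    using assms primes_dvd_imp_eq[of 2 p] primes_dvd_imp_eq[of 3 p] by auto
  then show ?thesis
    by presburger
qed

theorem theorem1:
  fixes N p1 p2 :: nat
  assumes "N \<ge> 14" and "even N"
    and "prime p1" and "prime p2" and "N = p1 + p2"
  shows "(N mod 6 = 2 \<longrightarrow>
            (p1 = 3 \<and> p2 \<in> column_D) \<or> (p2 = 3 \<and> p1 \<in> column_D) \<or>
            (p1 \<in> column_F \<and> p2 \<in> column_F)) \<and>
         (N mod 6 = 4 \<longrightarrow>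
            (p1 = 3 \<and> p2 \<in> column_F) \<or> (p2 = 3 \<and> p1 \<in> column_F) \<or>
            (p1 \<in> column_D \<and> p2 \<in> column_D)) \<and>
         (N mod 6 = 0 \<longrightarrow>
            (p1 \<in> column_D \<and> p2 \<in> column_F) \<or> (p1 \<in> column_F \<and> p2 \<in> column_D))"
proof -
  have "even (p1 + p2)" "p1 + p2 \<ge> 14" "p1 \<noteq> 1" "p2 \<noteq> 1"
    using assms by auto
  \<comment> \<open>If one summand were 2, the other would be an even prime, making the sum
    4.\<close>
  moreover have "p1 \<noteq> 2" "p2 \<noteq> 2"
    using calculation prime_odd_nat[of p1] prime_odd_nat[of p2] assms(3,4)
    by (auto dest: primes_dvd_imp_eq[OF two_is_prime_nat])
  moreover have "(p1 + p2) mod 6 = (p1 mod 6 + p2 mod 6) mod 6"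
    by (simp add: mod_add_eq)
  ultimately show ?thesis
    using prime_mod_6[OF \<open>prime p1\<close>] prime_mod_6[OF \<open>prime p2\<close>]
    unfolding column_D_iff column_F_iff \<open>N = p1 + p2\<close>
    \<comment> \<open>The pair 3, 3 is ruled out by its sum 6 < 14.\<close>
    by (elim disjE) simp_all
qed

end
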